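(* Let $m\ge 1$, let $\varrho=(\varrho_1,\dots,\varrho_m)$ be a vector of non-negative integers, and let $Q_\varrho=\prod_{j=1}^m\{0,1,\dots,\varrho_j\}$. For a subset $\mathcal F\subseteq Q_\varrho$, consider the following properties. (F1) $\varrho\in\mathcal F$. (F2) $\mathcal F$ is closed under the meet $\wedge$. (F3) If $a\in\mathcal F$ and $i\in\{1,\dots,m\}$ is such that $a+e_i\in Q_\varrho$, then there exists $b\in\mathcal F$ such that $b\succeq a+e_i$ and $b$ covers $a$ in $\mathcal F$. (F* ) For every $i\in\{1,\dots,m\}$ and $t\in\{0,\dots,\varrho_i\}$, the layer $L^i_t=\{x\in Q_\varrho : x_i=t\}$ contains an element of $\mathcal F$. Then the set of flats $\mathcal F$ of a matricube $\mathscr M$ with ground set $Q_\varrho$ satisfies (F1), (F2) and (F3). Conversely, if $\mathcal F\subseteq Q_\varrho$ satisfies (F1), (F2) and (F3), then $\mathcal F$ is the set of flats of a matricube $\mathscr M$ with ground set $Q_\varrho$. Moreover, the matricube $\mathscr M$ is simple if and only if (F* ) holds.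
   Context: $Q_\varrho$ is ordered coordinatewise: $x\preceq y$ iff $x_j\le y_j$ for all $j$. The operations $\vee$ and $\wedge$ are the coordinatewise maximum and minimum. $e_i$ is the $i$-th unit vector. A matricube $\mathscr M$ with ground set $Q_\varrho$ is given by a function $\mathbf r:Q_\varrho\to\mathbb Z$ (its rank function) such that: (R1) $\mathbf r(0)=0$ and $\mathbf r(t\,e_i)-\mathbf r((t-1)e_i)\le 1$ for all $1\le i\le m$ and $1\le t\le \varrho_i$; (R2) $x\preceq y$ implies $\mathbf r(x)\le\mathbf r(y)$; (R3) $\mathbf r(x)+\mathbf r(y)\ge \mathbf r(x\vee y)+\mathbf r(x\wedge y)$ for all $x,y\in Q_\varrho$. It is simple if $\varrho_i>0$ and $\mathbf r(t\,e_i)=t$ for all $i$ and all $t\in\{0,\dots,\varrho_i\}$. A point $a\in Q_\varrho$ is a flat of $\mathscr M$ if for every $i$ with $a+e_i\in Q_\varrho$ one has $\mathbf r(a+e_i)=\mathbf r(a)+1$. For $\mathcal F\subseteq Q_\varrho$ with the induced order, $b$ covers $a$ in $\mathcal F$ if $a,b\in\mathcal F$, $a\prec b$, and there is no $c\in\mathcal F$ with $a\prec c\prec b$.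
   Formalization: The last claim is proved as "simple iff all ϱ_i > 0 and (F* )": as stated it fails when some ϱ_i = 0 (m = 1, ϱ = 0, r = 0: (F* ) holds, but simple requires ϱ_1 > 0). *)

theory Defs
  imports Main "HOL-Library.Function_Algebras"
begin

text \<open>
  Points are functions \<open>'n \<Rightarrow> nat\<close> on a finite index type of cardinality \<open>m\<close>; being nonempty, it
  gives \<open>m \<ge> 1\<close>. The library's pointwise order, \<open>inf\<close> and \<open>sup\<close> on functions are then the
  coordinatewise order, minimum and maximum, and \<open>0\<close>, \<open>+\<close> are pointwise.
\<close>

abbreviation hypercuboid :: "('n::finite \<Rightarrow> nat) \<Rightarrow> ('n \<Rightarrow> nat) set" where
  "hypercuboid \<rho> \<equiv> {x. x \<le> \<rho>}"

text \<open>\<open>axis_pt i t\<close> is the point \<open>t e\<^sub>i\<close>.\<close>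

definition axis_pt :: "'n::finite \<Rightarrow> nat \<Rightarrow> 'n \<Rightarrow> nat" where
  "axis_pt i t = (\<lambda>j. if j = i then t else 0)"

abbreviation unit_pt :: "'n::finite \<Rightarrow> 'n \<Rightarrow> nat" where
  "unit_pt i \<equiv> axis_pt i 1"

text \<open>
  A matricube is given by its rank function on \<open>hypercuboid \<rho>\<close>. HOL functions being total, the
  values of \<open>r\<close> outside the hypercuboid are unconstrained and irrelevant.
\<close>

definition matricube :: "('n::finite \<Rightarrow> nat) \<Rightarrow> (('n \<Rightarrow> nat) \<Rightarrow> int) \<Rightarrow> bool" where
  "matricube \<rho> r \<longleftrightarrow>
     (r 0 = 0 \<and> (\<forall>i. \<forall>t\<in>{1..\<rho> i}. r (axis_pt i t) - r (axis_pt i (t - 1)) \<le> 1)) \<and>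
     (\<forall>x\<in>hypercuboid \<rho>. \<forall>y\<in>hypercuboid \<rho>. x \<le> y \<longrightarrow> r x \<le> r y) \<and>
     (\<forall>x\<in>hypercuboid \<rho>. \<forall>y\<in>hypercuboid \<rho>. r x + r y \<ge> r (sup x y) + r (inf x y))"

definition simple_matricube :: "('n::finite \<Rightarrow> nat) \<Rightarrow> (('n \<Rightarrow> nat) \<Rightarrow> int) \<Rightarrow> bool" where
  "simple_matricube \<rho> r \<longleftrightarrow>
     matricube \<rho> r \<and> (\<forall>i. \<rho> i > 0 \<and> (\<forall>t\<in>{0..\<rho> i}. r (axis_pt i t) = int t))"

definition flats :: "('n::finite \<Rightarrow> nat) \<Rightarrow> (('n \<Rightarrow> nat) \<Rightarrow> int) \<Rightarrow> ('n \<Rightarrow> nat) set" where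
  "flats \<rho> r = {a \<in> hypercuboid \<rho>.
     \<forall>i. a + unit_pt i \<in> hypercuboid \<rho> \<longrightarrow> r (a + unit_pt i) = r a + 1}"

definition covers_in :: "'a::order set \<Rightarrow> 'a \<Rightarrow> 'a \<Rightarrow> bool" where
  "covers_in F b a \<longleftrightarrow> a \<in> F \<and> b \<in> F \<and> a < b \<and> \<not> (\<exists>c\<in>F. a < c \<and> c < b)"

definition F1 :: "('n::finite \<Rightarrow> nat) \<Rightarrow> ('n \<Rightarrow> nat) set \<Rightarrow> bool" where
  "F1 \<rho> F \<longleftrightarrow> \<rho> \<in> F"

definition F2 :: "('n::finite \<Rightarrow> nat) set \<Rightarrow> bool" where
  "F2 F \<longleftrightarrow> (\<forall>a\<in>F. \<forall>b\<in>F. inf a b \<in> F)"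

definition F3 :: "('n::finite \<Rightarrow> nat) \<Rightarrow> ('n \<Rightarrow> nat) set \<Rightarrow> bool" where
  "F3 \<rho> F \<longleftrightarrow> (\<forall>a\<in>F. \<forall>i. a + unit_pt i \<in> hypercuboid \<rho> \<longrightarrow>
     (\<exists>b\<in>F. b \<ge> a + unit_pt i \<and> covers_in F b a))"

definition layer :: "('n::finite \<Rightarrow> nat) \<Rightarrow> 'n \<Rightarrow> nat \<Rightarrow> ('n \<Rightarrow> nat) set" where
  "layer \<rho> i t = {x \<in> hypercuboid \<rho>. x i = t}"

text \<open>
  Where \<open>\<rho> i = 0\<close>, the condition holds for every \<open>F\<close> containing \<open>\<rho>\<close>, while simplicity fails. So \<open>Fstar\<close>
  characterizes simplicity only together with positivity of all \<open>\<rho> i\<close>.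
\<close>

definition Fstar :: "('n::finite \<Rightarrow> nat) \<Rightarrow> ('n \<Rightarrow> nat) set \<Rightarrow> bool" where
  "Fstar \<rho> F \<longleftrightarrow> (\<forall>i. \<forall>t\<in>{0..\<rho> i}. layer \<rho> i t \<inter> F \<noteq> {})"

end

theory Submission
  imports Defs "HOL-Library.FuncSet"
begin

text \<open>
  Everything is governed by the increments \<open>r (x + e\<^sub>i) - r x\<close>. In a matricube, submodularity says
  that such an increment can only decrease when \<open>x\<close> grows with \<open>x i\<close> held fixed
  (\<open>rank_increment_antimono\<close>); comparing \<open>x\<close> with its \<open>i\<close>-th axis point shows that every increment
  is \<open>0\<close> or \<open>1\<close>. A flat is a point where all increments within the grid are \<open>1\<close>. Hence a meet of two flats is a
  flat, since in each direction the meet agrees with one of the two and lies below it. A point that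
  is maximal among those of a given rank above \<open>x\<close> is a flat, so \<open>a + e\<^sub>i\<close> lies below a flat of the
  same rank; when \<open>a\<close> is a flat, this flat has rank \<open>r a + 1\<close> and covers \<open>a\<close>, because ranks
  increase strictly along flats. Apart from the positivity of \<open>\<rho>\<close>, simplicity says that all increments along the axes are \<open>1\<close>; it
  is related to the layers by the same two tools: a flat in the layer \<open>x i = t\<close> forces the increment
  from \<open>t e\<^sub>i\<close> to be \<open>1\<close>, and conversely a flat above \<open>t e\<^sub>i\<close> of the same rank \<open>t\<close> cannot
  leave the layer.

  For the converse, let \<open>cl x\<close> be the least element of \<open>F\<close> above \<open>x\<close>. By (F3), \<open>cl (a + e\<^sub>i)\<close>
  covers \<open>a\<close> whenever \<open>a\<close> is in \<open>F\<close> and \<open>a + e\<^sub>i\<close> in the grid. This makes \<open>F\<close> an upper semimodular lattice, and so, as in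
  the Jordan--Dedekind theorem, all saturated chains from a given element up to \<open>\<rho>\<close> have the same
  length, its corank. The rank of \<open>x\<close> is defined as the corank of \<open>cl 0\<close> minus that of \<open>cl x\<close>.
  Its increment in direction \<open>i\<close> is \<open>1\<close> when \<open>cl x\<close> has the same \<open>i\<close>-th coordinate as \<open>x\<close>, and \<open>0\<close>
  otherwise (\<open>rank_add_unit_eq\<close>). Monotonicity of \<open>cl\<close> then gives decreasing increments,
  which add up to submodularity along a lattice path (\<open>matricubeI_increments\<close>), and \<open>x\<close> is a flat
  exactly when \<open>cl x = x\<close>.
\<close>

section \<open>The grid\<close>

lemma le_add_unit: "x \<le> x + unit_pt i"
  by (simp add: le_fun_def)

lemma add_unit_le_iff: "x + unit_pt i \<le> y \<longleftrightarrow> x \<le> y \<and> x i < y i"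
proof
  assume le: "x + unit_pt i \<le> y"
  then have "(x + unit_pt i) i \<le> y i" by (rule le_funD)
  with order_trans[OF le_add_unit le] show "x \<le> y \<and> x i < y i"
    by (simp add: axis_pt_def)
qed (auto simp: le_fun_def axis_pt_def)

lemma less_add_unit: "x < x + unit_pt i"
  unfolding less_le_not_le add_unit_le_iff using le_add_unit by blast

lemma less_imp_ex_coord_less:
  fixes x y :: "'n::finite \<Rightarrow> nat"
  assumes "x < y"
  obtains i where "x i < y i"
proof -
  have "\<not> y \<le> x" using assms by (simp add: less_le_not_le)
  then obtain i where "\<not> y i \<le> x i" unfolding le_fun_def by blast
  then show thesis using that[of i] by simp
qed

lemma axis_pt_same: "axis_pt i t i = t"
  by (simp add: axis_pt_def)

lemma axis_pt_0: "axis_pt i 0 = 0"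
  by (simp add: axis_pt_def fun_eq_iff)

lemma axis_pt_Suc: "axis_pt i (Suc t) = axis_pt i t + unit_pt i"
  by (auto simp: axis_pt_def fun_eq_iff)

lemma axis_pt_le_iff: "axis_pt i t \<le> x \<longleftrightarrow> t \<le> x i"
  by (auto simp: axis_pt_def le_fun_def)

lemma finite_hypercuboid: "finite (hypercuboid \<rho>)"
proof (rule finite_subset)
  show "hypercuboid \<rho> \<subseteq> PiE UNIV (\<lambda>i. {..\<rho> i})"
    by (auto simp: le_fun_def)
qed (auto intro: finite_PiE)

text \<open>
  Any two comparable points are joined by a path of unit steps that stays between them; induction
  along it turns statements about increments into statements about arbitrary pairs of points.
\<close>

lemma lattice_path_induct [consumes 1, case_names start step]:
  fixes x y :: "'n::finite \<Rightarrow> nat"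
  assumes "x \<le> y" "P x"
    and step: "\<And>z i. x \<le> z \<Longrightarrow> z + unit_pt i \<le> y \<Longrightarrow> P z \<Longrightarrow> P (z + unit_pt i)"
  shows "P y"
proof -
  let ?S = "{z. z \<le> y \<and> x \<le> z \<and> P z}"
  have fin: "finite ?S" by (rule finite_subset[OF _ finite_hypercuboid[of y]]) auto
  have ne: "?S \<noteq> {}" using assms(1,2) by blast
  obtain z where z: "z \<in> ?S" and max: "\<And>w. w \<in> ?S \<Longrightarrow> z \<le> w \<Longrightarrow> z = w"
    using finite_has_maximal[OF fin ne] by blast
  have "\<not> z < y"
  proof
    assume "z < y"
    then obtain i where "z i < y i" by (rule less_imp_ex_coord_less)
    then have "z + unit_pt i \<le> y" using z by (simp only: add_unit_le_iff) simp
    then have "z + unit_pt i \<in> ?S"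
      using z step[of z i] order_trans[OF _ le_add_unit, of x z i] by simp
    from max[OF this le_add_unit] show False using less_imp_neq[OF less_add_unit] by blast
  qed
  with z show "P y" by (auto simp: less_le)
qed

section \<open>Flats of a matricube\<close>

context
  fixes \<rho> :: "'n::finite \<Rightarrow> nat" and r :: "('n \<Rightarrow> nat) \<Rightarrow> int"
  assumes matricube: "matricube \<rho> r"
begin

lemma rank_mono: "x \<le> y \<Longrightarrow> y \<le> \<rho> \<Longrightarrow> r x \<le> r y"
  using matricube order_trans[of x y \<rho>] unfolding matricube_def by simp

lemma rank_submodular: "x \<le> \<rho> \<Longrightarrow> y \<le> \<rho> \<Longrightarrow> r (sup x y) + r (inf x y) \<le> r x + r y"
  using matricube unfolding matricube_def by blast

text \<open>
  Submodularity for \<open>x + e\<^sub>i\<close> and \<open>y\<close>, whose join is \<open>y + e\<^sub>i\<close> and whose meet is \<open>x\<close>. The condition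
  \<open>x i = y i\<close> is essential: it is what makes the join differ from \<open>y\<close>.
\<close>

lemma rank_increment_antimono:
  assumes "x \<le> y" "x i = y i" "y + unit_pt i \<le> \<rho>"
  shows "r (y + unit_pt i) - r y \<le> r (x + unit_pt i) - r x"
proof -
  have y: "y \<le> \<rho>" "y i < \<rho> i" using assms(3) by (simp_all only: add_unit_le_iff)
  then have x: "x + unit_pt i \<le> \<rho>"
    unfolding add_unit_le_iff using assms(1,2) order_trans[OF assms(1) y(1)] by simp
  have "sup (x + unit_pt i) y = y + unit_pt i" "inf (x + unit_pt i) y = x"
    using assms(1,2) by (auto simp: fun_eq_iff axis_pt_def le_fun_def sup_nat_def inf_nat_def)
  with rank_submodular[OF x y(1)] show ?thesis by simp
qed

lemma rank_axis_increment_le_1: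
  assumes "t < \<rho> i"
  shows "r (axis_pt i t + unit_pt i) - r (axis_pt i t) \<le> 1"
proof -
  have "Suc t \<in> {1..\<rho> i}" using assms by simp
  then have "r (axis_pt i (Suc t)) - r (axis_pt i (Suc t - 1)) \<le> 1"
    using matricube unfolding matricube_def by blast
  then show ?thesis unfolding axis_pt_Suc[of i t] diff_Suc_1 .
qed

text \<open>
  The axis point \<open>x i \<cdot> e\<^sub>i\<close> lies below \<open>x\<close> and has the same \<open>i\<close>-th coordinate, so the bound on
  increments along the axes carries over to all points.
\<close>

lemma rank_add_unit:
  assumes "x + unit_pt i \<le> \<rho>"
  shows "r (x + unit_pt i) = r x \<or> r (x + unit_pt i) = r x + 1"
proof -
  have "x i < \<rho> i" using assms by (simp only: add_unit_le_iff)
  have "r (x + unit_pt i) - r x \<le> r (axis_pt i (x i) + unit_pt i) - r (axis_pt i (x i))"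
    by (rule rank_increment_antimono[OF _ _ assms]) (simp_all add: axis_pt_le_iff axis_pt_same)
  with rank_axis_increment_le_1[OF \<open>x i < \<rho> i\<close>] rank_mono[OF le_add_unit assms]
  show ?thesis by linarith
qed

lemma flatD: "a \<in> flats \<rho> r \<Longrightarrow> a + unit_pt i \<le> \<rho> \<Longrightarrow> r (a + unit_pt i) = r a + 1"
  by (simp add: flats_def)

lemma flats_le: "a \<in> flats \<rho> r \<Longrightarrow> a \<le> \<rho>"
  by (simp add: flats_def)

text \<open>The path from a flat to any strictly larger point may start with a step that raises the rank.\<close>

lemma flat_rank_less:
  assumes "a \<in> flats \<rho> r" "a < x" "x \<le> \<rho>"
  shows "r a < r x"
proof -
  obtain i where "a i < x i" using assms(2) by (rule less_imp_ex_coord_less)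
  then have le: "a + unit_pt i \<le> x" using assms(2) by (simp only: add_unit_le_iff) simp
  show ?thesis
    using flatD[OF assms(1) order_trans[OF le assms(3)]] rank_mono[OF le assms(3)] by linarith
qed

text \<open>
  A maximal point of the given rank above \<open>x\<close> is a flat: a step away from it must change the rank,
  hence raises it by \<open>1\<close>.
\<close>

lemma flat_above_of_same_rank:
  assumes "x \<le> \<rho>"
  obtains b where "b \<in> flats \<rho> r" "x \<le> b" "r b = r x"
proof -
  let ?S = "{b. b \<le> \<rho> \<and> x \<le> b \<and> r b = r x}"
  have fin: "finite ?S" by (rule finite_subset[OF _ finite_hypercuboid[of \<rho>]]) auto
  have ne: "?S \<noteq> {}" using assms by blast
  obtain b where b: "b \<in> ?S" and max: "\<And>c. c \<in> ?S \<Longrightarrow> b \<le> c \<Longrightarrow> b = c"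
    using finite_has_maximal[OF fin ne] by blast
  have "r (b + unit_pt i) = r b + 1" if le: "b + unit_pt i \<le> \<rho>" for i
  proof (rule ccontr)
    assume "\<not> ?thesis"
    then have "b + unit_pt i \<in> ?S"
      using rank_add_unit[OF le] b le order_trans[OF _ le_add_unit, of x b i] by simp
    from max[OF this le_add_unit] show False using less_imp_neq[OF less_add_unit] by blast
  qed
  then have "b \<in> flats \<rho> r" using b by (simp add: flats_def)
  with b that show thesis by simp
qed

lemma flats_F1: "F1 \<rho> (flats \<rho> r)"
  unfolding F1_def flats_def using less_add_unit[of \<rho>] by (auto simp: less_le_not_le)

lemma flats_F2: "F2 (flats \<rho> r)"
  unfolding F2_def
proof (intro ballI)
  \<comment> \<open>In direction \<open>i\<close>, compare the meet with the argument that has the smaller \<open>i\<close>-th coordinate.\<close>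
  have *: "r (inf a b + unit_pt i) = r (inf a b) + 1"
    if "a \<in> flats \<rho> r" "inf a b + unit_pt i \<le> \<rho>" "a i \<le> b i" for a b i
  proof -
    have i: "inf a b i = a i" using that(3) by (simp add: inf_nat_def)
    have le: "a + unit_pt i \<le> \<rho>"
      using that flats_le i by (simp add: add_unit_le_iff del: One_nat_def)
    show ?thesis
      using rank_increment_antimono[OF inf_le1 i le] flatD[OF that(1) le] rank_add_unit[OF that(2)]
      by linarith
  qed
  fix a b assume ab: "a \<in> flats \<rho> r" "b \<in> flats \<rho> r"
  have "r (inf a b + unit_pt i) = r (inf a b) + 1" if "inf a b + unit_pt i \<le> \<rho>" for i
    using *[OF ab(1) that] *[OF ab(2), of a i] that
    by (cases "a i \<le> b i") (simp_all add: inf_commute)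
  moreover have "inf a b \<le> \<rho>" using flats_le[OF ab(1)] by (rule le_infI1)
  ultimately show "inf a b \<in> flats \<rho> r" by (simp add: flats_def)
qed

text \<open>
  The covering flat is one of rank \<open>r a + 1\<close> above \<open>a + e\<^sub>i\<close>: a flat strictly in between would have
  a rank strictly between \<open>r a\<close> and \<open>r a + 1\<close>.
\<close>

lemma flats_F3: "F3 \<rho> (flats \<rho> r)"
  unfolding F3_def
proof (intro ballI allI impI)
  fix a i assume a: "a \<in> flats \<rho> r" and "a + unit_pt i \<in> hypercuboid \<rho>"
  then have le: "a + unit_pt i \<le> \<rho>" by simp
  obtain b where b: "b \<in> flats \<rho> r" "a + unit_pt i \<le> b" "r b = r (a + unit_pt i)"
    using flat_above_of_same_rank[OF le] .
  have "a < b" using less_add_unit b(2) by (rule less_le_trans)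
  moreover have "\<not> (a < c \<and> c < b)" if "c \<in> flats \<rho> r" for c
    using flat_rank_less[OF a, of c] flat_rank_less[OF that, of b] flats_le[OF b(1)] flats_le[OF that]
      b(3) flatD[OF a le] by auto
  ultimately show "\<exists>b\<in>flats \<rho> r. a + unit_pt i \<le> b \<and> covers_in (flats \<rho> r) b a"
    using a b by (auto simp: covers_in_def)
qed

text \<open>
  Raising \<open>t e\<^sub>i\<close> to a flat \<open>b\<close> of the same rank \<open>t\<close> keeps it in its layer, since
  \<open>b i = r (b i \<cdot> e\<^sub>i) \<le> r b = t\<close>.
\<close>

lemma Fstar_if_simple:
  assumes "simple_matricube \<rho> r"
  shows "Fstar \<rho> (flats \<rho> r)"
  unfolding Fstar_def
proof (intro allI ballI)
  have axis: "r (axis_pt i t) = int t" if "t \<le> \<rho> i" for i t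
    using assms that by (simp add: simple_matricube_def)
  fix i t assume "t \<in> {0..\<rho> i}"
  then have t: "t \<le> \<rho> i" by simp
  then obtain b where b: "b \<in> flats \<rho> r" "axis_pt i t \<le> b" "r b = r (axis_pt i t)"
    using flat_above_of_same_rank by (metis axis_pt_le_iff)
  have "r (axis_pt i (b i)) \<le> r b"
    by (rule rank_mono) (simp_all add: axis_pt_le_iff flats_le[OF b(1)])
  moreover have "b i \<le> \<rho> i" using flats_le[OF b(1)] by (simp add: le_fun_def)
  ultimately have "b i = t"
    using b(2,3) axis[OF t] axis by (simp add: axis_pt_le_iff)
  then show "layer \<rho> i t \<inter> flats \<rho> r \<noteq> {}"
    using b(1) flats_le by (auto simp: layer_def)
qed

text \<open>
  A flat in the layer at height \<open>t < \<rho> i\<close> has increment \<open>1\<close> in direction \<open>i\<close>, and \<open>t e\<^sub>i\<close> lies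
  below it with the same \<open>i\<close>-th coordinate, so its increment is \<open>1\<close> as well.
\<close>

lemma simple_if_Fstar:
  assumes pos: "\<forall>i. \<rho> i > 0" and "Fstar \<rho> (flats \<rho> r)"
  shows "simple_matricube \<rho> r"
proof -
  have "r (axis_pt i t) = int t" if "t \<le> \<rho> i" for i t
    using that
  proof (induction t)
    case 0
    have "r 0 = 0" using matricube unfolding matricube_def by blast
    then show ?case by (simp only: axis_pt_0 of_nat_0)
  next
    case (Suc t)
    obtain x where x: "x \<in> flats \<rho> r" "x i = t"
      using assms(2) Suc.prems unfolding Fstar_def layer_def by fastforce
    have le: "x + unit_pt i \<le> \<rho>"
      using x flats_le Suc.prems by (simp add: add_unit_le_iff del: One_nat_def)
    have "r (x + unit_pt i) - r x \<le> r (axis_pt i t + unit_pt i) - r (axis_pt i t)"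
      by (rule rank_increment_antimono[OF _ _ le]) (simp_all add: axis_pt_le_iff axis_pt_same x(2))
    moreover have "r (axis_pt i t) = int t" "t < \<rho> i" using Suc by simp_all
    ultimately have "r (axis_pt i t + unit_pt i) = 1 + int t"
      using flatD[OF x(1) le] rank_axis_increment_le_1[of t i] by linarith
    then show ?case unfolding axis_pt_Suc[of i t] of_nat_Suc .
  qed
  then show ?thesis using matricube pos by (simp add: simple_matricube_def)
qed

end

section \<open>Recognizing rank functions by their increments\<close>

text \<open>
  For submodularity, move from \<open>inf x y\<close> to \<open>x\<close> along a lattice path. Each step of the path is
  accompanied by at most one step, in the same direction, of its join with \<open>y\<close>, and that one gains
  no more rank.
\<close>

lemma matricubeI_increments:
  fixes \<rho> :: "'n::finite \<Rightarrow> nat" and r :: "('n \<Rightarrow> nat) \<Rightarrow> int"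
  assumes zero: "r 0 = 0"
    and incr: "\<And>x i. x + unit_pt i \<le> \<rho> \<Longrightarrow> 0 \<le> r (x + unit_pt i) - r x \<and> r (x + unit_pt i) - r x \<le> 1"
    and antimono: "\<And>x y i. x \<le> y \<Longrightarrow> x i = y i \<Longrightarrow> y + unit_pt i \<le> \<rho> \<Longrightarrow>
      r (y + unit_pt i) - r y \<le> r (x + unit_pt i) - r x"
  shows "matricube \<rho> r"
proof -
  have axis: "r (axis_pt i t) - r (axis_pt i (t - 1)) \<le> 1" if "t \<in> {1..\<rho> i}" for i t
  proof -
    from that have "t \<noteq> 0" by simp
    then obtain s where s: "t = Suc s" by (cases t) auto
    then have "axis_pt i s + unit_pt i \<le> \<rho>"
      using that by (simp add: s axis_pt_Suc[of i s, symmetric] axis_pt_le_iff del: One_nat_def)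
    from incr[OF this] show ?thesis unfolding s axis_pt_Suc[of i s] diff_Suc_1 by simp
  qed
  have mono: "r x \<le> r y" if "x \<le> y" "y \<le> \<rho>" for x y
    using that(1)
  proof (induction rule: lattice_path_induct)
    case (step z i)
    then show ?case using incr[OF order_trans[OF step(2) that(2)]] by linarith
  qed simp
  have submodular: "r (sup x y) + r (inf x y) \<le> r x + r y" if "x \<le> \<rho>" "y \<le> \<rho>" for x y
  proof (rule lattice_path_induct[OF inf_le1[of x y],
        where P = "\<lambda>z. r (sup z y) + r (inf x y) \<le> r z + r y"], goal_cases start step)
    case start
    then show ?case by (simp add: sup_absorb2)
  next
    case (step z i)
    have z: "z + unit_pt i \<le> \<rho>" using step(2) that(1) by (rule order_trans)
    show ?case
    proof (cases "z i < y i")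
      case True
      then have "sup (z + unit_pt i) y = sup z y"
        by (auto simp: fun_eq_iff axis_pt_def sup_nat_def)
      then show ?thesis using step(3) incr[OF z] by simp
    next
      case False
      \<comment> \<open>Here \<open>z\<close> and its join with \<open>y\<close> agree at \<open>i\<close>, as decreasing increments require.\<close>
      then have eq: "sup (z + unit_pt i) y = sup z y + unit_pt i"
        by (auto simp: fun_eq_iff axis_pt_def sup_nat_def)
      have "sup z y + unit_pt i \<le> \<rho>"
        unfolding eq[symmetric] using z that(2) by (rule le_supI)
      then have "r (sup z y + unit_pt i) - r (sup z y) \<le> r (z + unit_pt i) - r z"
        using False by (intro antimono) (auto simp: sup_nat_def)
      then show ?thesis unfolding eq using step(3) by linarith
    qed
  qed
  show ?thesis
    unfolding matricube_def using zero axis mono submodular by auto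
qed

section \<open>From flats back to a matricube\<close>

locale flat_family =
  fixes \<rho> :: "'n::finite \<Rightarrow> nat" and F :: "('n \<Rightarrow> nat) set"
  assumes sub: "F \<subseteq> hypercuboid \<rho>" and F1: "F1 \<rho> F" and F2: "F2 F" and F3: "F3 \<rho> F"
begin

lemma F_le: "a \<in> F \<Longrightarrow> a \<le> \<rho>"
  using sub by auto

lemma top_in_F: "\<rho> \<in> F"
  using F1 by (simp add: F1_def)

lemma finite_F: "finite F"
  using sub finite_hypercuboid by (rule finite_subset)

definition cl :: "('n \<Rightarrow> nat) \<Rightarrow> 'n \<Rightarrow> nat" where
  "cl x = (LEAST b. b \<in> F \<and> x \<le> b)"

lemma
  assumes "x \<le> \<rho>"
  shows cl_in_F: "cl x \<in> F" and cl_ge: "x \<le> cl x"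
    and cl_least: "\<And>b. b \<in> F \<Longrightarrow> x \<le> b \<Longrightarrow> cl x \<le> b"
proof -
  let ?S = "{b \<in> F. x \<le> b}"
  have fin: "finite ?S" and ne: "?S \<noteq> {}" using finite_F top_in_F assms by auto
  obtain m where m: "m \<in> ?S" and min: "\<And>b. b \<in> ?S \<Longrightarrow> b \<le> m \<Longrightarrow> m = b"
    using finite_has_minimal[OF fin ne] by blast
  have least: "m \<le> b" if "b \<in> F" "x \<le> b" for b
  proof -
    have "inf m b \<in> ?S" using m that F2 by (auto simp: F2_def)
    from min[OF this] show ?thesis by (metis inf_le1 inf_le2)
  qed
  have "cl x = m" unfolding cl_def by (rule Least_equality) (use m least in auto)
  with m least show "cl x \<in> F" "x \<le> cl x" "\<And>b. b \<in> F \<Longrightarrow> x \<le> b \<Longrightarrow> cl x \<le> b" by auto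
qed

lemma cl_le_iff: "x \<le> \<rho> \<Longrightarrow> b \<in> F \<Longrightarrow> cl x \<le> b \<longleftrightarrow> x \<le> b"
  using cl_ge cl_least by (meson order_trans)

lemma cl_eqI:
  assumes "x \<le> \<rho>" "y \<le> \<rho>" "\<And>b. b \<in> F \<Longrightarrow> x \<le> b \<longleftrightarrow> y \<le> b"
  shows "cl x = cl y"
  by (rule antisym) (use assms cl_le_iff cl_in_F cl_ge in auto)

lemma cl_mono: "x \<le> y \<Longrightarrow> y \<le> \<rho> \<Longrightarrow> cl x \<le> cl y"
  by (meson cl_ge cl_in_F cl_least order_trans)

lemma cl_eq_iff: "x \<le> \<rho> \<Longrightarrow> cl x = x \<longleftrightarrow> x \<in> F"
  using cl_in_F cl_ge cl_least by (metis antisym order_refl)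

lemma cl_le: "x \<le> \<rho> \<Longrightarrow> cl x \<le> \<rho>"
  by (simp add: cl_in_F F_le)

text \<open>
  The cover of \<open>a\<close> above \<open>a + e\<^sub>i\<close> that (F3) provides can only be the least element of \<open>F\<close>
  above \<open>a + e\<^sub>i\<close>, since that one lies strictly above \<open>a\<close> and below the cover.
\<close>

lemma cl_add_unit_covers:
  assumes "a \<in> F" "a + unit_pt i \<le> \<rho>"
  shows "covers_in F (cl (a + unit_pt i)) a"
proof -
  obtain b where b: "b \<in> F" "a + unit_pt i \<le> b" "covers_in F b a"
    using F3 assms unfolding F3_def by auto
  have "cl (a + unit_pt i) \<le> b" using assms(2) b(1,2) by (rule cl_least)
  moreover have "a < cl (a + unit_pt i)"
    using less_add_unit cl_ge[OF assms(2)] by (rule less_le_trans)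
  ultimately have "cl (a + unit_pt i) = b"
    using b(3) cl_in_F[OF assms(2)] by (auto simp: covers_in_def less_le)
  with b(3) show ?thesis by simp
qed

text \<open>
  Upper semimodularity. Choose a direction \<open>i\<close> in which \<open>b\<close> exceeds \<open>c\<close>, hence also \<open>a\<close>. Then
  \<open>b\<close> is the closure of \<open>a + e\<^sub>i\<close>, so an element of \<open>F\<close> lies above \<open>b\<close> and \<open>c\<close> exactly when it
  lies above \<open>c + e\<^sub>i\<close>, and the join in \<open>F\<close> is a cover of \<open>c\<close> by \<open>cl_add_unit_covers\<close>.
\<close>

lemma cover_join:
  assumes "covers_in F b a" "c \<in> F" "a \<le> c" "\<not> b \<le> c"
  shows "covers_in F (cl (sup b c)) c"
proof -
  have ab: "a \<in> F" "b \<in> F" "a < b" using assms(1) by (auto simp: covers_in_def)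
  from assms(4) obtain i where i: "c i < b i" by (auto simp: le_fun_def not_le)
  have b\<rho>: "b \<le> \<rho>" and c\<rho>: "c \<le> \<rho>" using ab assms(2) F_le by auto
  have ai: "a i < b i" using i assms(3) by (metis le_fun_def le_less_trans)
  have ale: "a + unit_pt i \<le> b" using ab(3) ai by (simp only: add_unit_le_iff) simp
  have cle: "c + unit_pt i \<le> \<rho>"
    using i c\<rho> b\<rho> by (simp only: add_unit_le_iff) (metis le_fun_def less_le_trans)
  \<comment> \<open>The closure lies above \<open>a\<close> and below \<open>b\<close>, and nothing in \<open>F\<close> fits strictly between these.\<close>
  have "b = cl (a + unit_pt i)"
    using assms(1) cl_add_unit_covers[OF ab(1) order_trans[OF ale b\<rho>]]
      cl_least[OF order_trans[OF ale b\<rho>] ab(2) ale]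
    by (auto simp: covers_in_def less_le)
  then have b_le: "b \<le> f" if "f \<in> F" "a + unit_pt i \<le> f" for f
    using cl_least[OF order_trans[OF ale b\<rho>] that] by simp
  have "cl (sup b c) = cl (c + unit_pt i)"
  proof (rule cl_eqI)
    fix f assume f: "f \<in> F"
    have "a + unit_pt i \<le> c + unit_pt i" using assms(3) by (simp add: le_fun_def)
    then have "b \<le> f" if "c + unit_pt i \<le> f" using b_le[OF f] that order_trans by blast
    moreover have "c i < f i" if "b \<le> f" using i that by (metis le_fun_def less_le_trans)
    ultimately show "sup b c \<le> f \<longleftrightarrow> c + unit_pt i \<le> f"
      unfolding le_sup_iff add_unit_le_iff by blast
  qed (use b\<rho> c\<rho> cle in auto)
  with cl_add_unit_covers[OF assms(2) cle] show ?thesis by simp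
qed

lemma semimodular:
  assumes b: "covers_in F b a" and c: "covers_in F c a" and "b \<noteq> c"
  obtains d where "covers_in F d b" "covers_in F d c"
proof -
  have "\<not> b \<le> c" "\<not> c \<le> b" "b \<in> F" "c \<in> F" "a \<le> b" "a \<le> c"
    using assms by (auto simp: covers_in_def less_le)
  then have "covers_in F (cl (sup b c)) c" "covers_in F (cl (sup c b)) b"
    using cover_join b c by blast+
  with that show thesis by (simp add: sup_commute)
qed

text \<open>Induction on a finite order from the top downwards.\<close>

lemma F_induct [consumes 1, case_names above]:
  assumes "a \<in> F" and above: "\<And>a. a \<in> F \<Longrightarrow> (\<And>b. b \<in> F \<Longrightarrow> a < b \<Longrightarrow> P b) \<Longrightarrow> P a"
  shows "P a"
  using assms(1)
proof (induction "card {b \<in> F. a < b}" arbitrary: a rule: less_induct)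
  case less
  show ?case
  proof (rule above[OF less.prems])
    fix b assume b: "b \<in> F" "a < b"
    have "card {c \<in> F. b < c} < card {c \<in> F. a < c}"
      by (rule psubset_card_mono) (use b finite_F in auto)
    then show "P b" using less.hyps b(1) by blast
  qed
qed

definition cover_rel :: "(('n \<Rightarrow> nat) \<times> ('n \<Rightarrow> nat)) set" where
  "cover_rel = {(a, b). covers_in F b a}"

lemma ex_saturated_chain: "a \<in> F \<Longrightarrow> \<exists>n. (a, \<rho>) \<in> cover_rel ^^ n"
proof (induction a rule: F_induct)
  case (above a)
  show ?case
  proof (cases "a = \<rho>")
    case True
    then have "(a, \<rho>) \<in> cover_rel ^^ 0" by simp
    then show ?thesis ..
  next
    case False
    then obtain i where "a i < \<rho> i"
      using F_le[OF above(1)] less_imp_ex_coord_less[of a \<rho>] by (auto simp: less_le)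
    then have "a + unit_pt i \<le> \<rho>" using F_le[OF above(1)] by (simp only: add_unit_le_iff)
    then have b: "covers_in F (cl (a + unit_pt i)) a" by (rule cl_add_unit_covers[OF above(1)])
    then obtain n where "(cl (a + unit_pt i), \<rho>) \<in> cover_rel ^^ n"
      using above(2) unfolding covers_in_def by blast
    with b have "(a, \<rho>) \<in> cover_rel ^^ Suc n"
      by (intro relpow_Suc_I2) (auto simp: cover_rel_def)
    then show ?thesis ..
  qed
qed

text \<open>
  The Jordan--Dedekind argument: two chains from \<open>a\<close> that start with different covers \<open>b\<close> and \<open>c\<close>
  are compared with chains through a common cover \<open>d\<close> of \<open>b\<close> and \<open>c\<close>. Measuring towards \<open>\<rho>\<close>
  rather than from the bottom is what lets upper semimodularity alone drive the induction.
\<close>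

lemma saturated_chain_length_unique:
  "a \<in> F \<Longrightarrow> (a, \<rho>) \<in> cover_rel ^^ n \<Longrightarrow> (a, \<rho>) \<in> cover_rel ^^ m \<Longrightarrow> n = m"
proof (induction a arbitrary: n m rule: F_induct)
  case (above a)
  have no_chain: "(\<rho>, \<rho>) \<notin> cover_rel ^^ Suc k" for k
  proof
    assume "(\<rho>, \<rho>) \<in> cover_rel ^^ Suc k"
    then obtain b where "(\<rho>, b) \<in> cover_rel" by (blast elim: relpow_Suc_E2)
    then show False using F_le by (auto simp: cover_rel_def covers_in_def less_le_not_le)
  qed
  show ?case
  proof (cases "a = \<rho>")
    case True
    then show ?thesis using above.prems no_chain by (cases n; cases m) blast+
  next
    case False
    then obtain n' m' where nm: "n = Suc n'" "m = Suc m'"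
      using above.prems by (cases n; cases m) auto
    obtain b where b: "covers_in F b a" "(b, \<rho>) \<in> cover_rel ^^ n'"
      using relpow_Suc_E2[OF above.prems(1)[unfolded nm]] unfolding cover_rel_def by blast
    obtain c where c: "covers_in F c a" "(c, \<rho>) \<in> cover_rel ^^ m'"
      using relpow_Suc_E2[OF above.prems(2)[unfolded nm]] unfolding cover_rel_def by blast
    have IH_b: "k = n'" if "(b, \<rho>) \<in> cover_rel ^^ k" for k
      using above.IH[of b k n'] b that by (auto simp: covers_in_def)
    have IH_c: "k = m'" if "(c, \<rho>) \<in> cover_rel ^^ k" for k
      using above.IH[of c k m'] c that by (auto simp: covers_in_def)
    show ?thesis
    proof (cases "b = c")
      case True
      then show ?thesis using IH_b c(2) nm by simp
    next
      case False
      obtain d where d: "covers_in F d b" "covers_in F d c"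
        using semimodular[OF b(1) c(1) False] .
      then obtain k where "(d, \<rho>) \<in> cover_rel ^^ k"
        using ex_saturated_chain unfolding covers_in_def by blast
      with d have "(b, \<rho>) \<in> cover_rel ^^ Suc k" "(c, \<rho>) \<in> cover_rel ^^ Suc k"
        by (auto simp: cover_rel_def simp del: relpow.simps intro!: relpow_Suc_I2)
      then show ?thesis using IH_b IH_c nm by metis
    qed
  qed
qed

definition corank :: "('n \<Rightarrow> nat) \<Rightarrow> nat" where
  "corank a = (THE n. (a, \<rho>) \<in> cover_rel ^^ n)"

lemma corank_eqI: "a \<in> F \<Longrightarrow> (a, \<rho>) \<in> cover_rel ^^ n \<Longrightarrow> corank a = n"
  unfolding corank_def using saturated_chain_length_unique by blast

lemma corank_cover:
  assumes "covers_in F b a"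
  shows "corank a = Suc (corank b)"
proof -
  have F: "a \<in> F" "b \<in> F" using assms by (auto simp: covers_in_def)
  obtain n where n: "(b, \<rho>) \<in> cover_rel ^^ n" using ex_saturated_chain F(2) by blast
  then have "(a, \<rho>) \<in> cover_rel ^^ Suc n"
    using assms by (intro relpow_Suc_I2) (auto simp: cover_rel_def)
  then show ?thesis using corank_eqI n F by metis
qed

definition rank :: "('n \<Rightarrow> nat) \<Rightarrow> int" where
  "rank x = int (corank (cl 0)) - int (corank (cl x))"

text \<open>
  If \<open>cl x\<close> already exceeds \<open>x\<close> at \<open>i\<close>, it is also the closure of \<open>x + e\<^sub>i\<close>. Otherwise the closure
  of \<open>x + e\<^sub>i\<close> is that of \<open>cl x + e\<^sub>i\<close>, a cover of \<open>cl x\<close>.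
\<close>

lemma rank_add_unit_eq:
  assumes "x + unit_pt i \<le> \<rho>"
  shows "rank (x + unit_pt i) = rank x + (if cl x i = x i then 1 else 0)"
proof -
  have x: "x \<le> \<rho>" "x i < \<rho> i" using assms by (simp_all only: add_unit_le_iff)
  have ge: "x i \<le> cl x i" using cl_ge[OF x(1)] by (simp add: le_fun_def)
  show ?thesis
  proof (cases "cl x i = x i")
    case True
    have le: "cl x + unit_pt i \<le> \<rho>"
      using True x cl_le[OF x(1)] by (simp only: add_unit_le_iff)
    have "cl (x + unit_pt i) = cl (cl x + unit_pt i)"
    proof (rule cl_eqI[OF assms le])
      fix b assume "b \<in> F"
      then show "x + unit_pt i \<le> b \<longleftrightarrow> cl x + unit_pt i \<le> b"
        unfolding add_unit_le_iff using True cl_le_iff[OF x(1)] by simp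
    qed
    then have "covers_in F (cl (x + unit_pt i)) (cl x)"
      using cl_add_unit_covers[OF cl_in_F[OF x(1)] le] by simp
    then show ?thesis using True corank_cover by (simp add: rank_def)
  next
    case False
    have "cl (x + unit_pt i) = cl x"
    proof (rule cl_eqI[OF assms x(1)])
      fix b assume b: "b \<in> F"
      have "x i < b i" if "x \<le> b"
      proof -
        have "cl x i \<le> b i" using cl_least[OF x(1) b that] by (simp add: le_fun_def)
        with False ge show ?thesis by simp
      qed
      then show "x + unit_pt i \<le> b \<longleftrightarrow> x \<le> b"
        unfolding add_unit_le_iff by blast
    qed
    then show ?thesis using False by (simp add: rank_def)
  qed
qed

text \<open>
  Increments decrease because, for \<open>x \<le> y\<close> with \<open>x i = y i\<close>, the inequalities
  \<open>x i \<le> cl x i \<le> cl y i\<close> force \<open>cl x\<close> to fix the \<open>i\<close>-th coordinate of \<open>x\<close> whenever \<open>cl y\<close>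
  fixes that of \<open>y\<close>.
\<close>

lemma matricube_rank: "matricube \<rho> rank"
proof (rule matricubeI_increments)
  fix x y :: "'n \<Rightarrow> nat" and i
  assume "x \<le> y" "x i = y i" and y: "y + unit_pt i \<le> \<rho>"
  have "y \<le> \<rho>" "y i < \<rho> i" using y by (simp_all only: add_unit_le_iff)
  then have "x \<le> \<rho>" using \<open>x \<le> y\<close> by (blast intro: order_trans)
  then have x: "x + unit_pt i \<le> \<rho>"
    unfolding add_unit_le_iff using \<open>x i = y i\<close> \<open>y i < \<rho> i\<close> by simp
  have "x i \<le> cl x i" "cl x i \<le> cl y i"
    using cl_ge[OF \<open>x \<le> \<rho>\<close>] cl_mono[OF \<open>x \<le> y\<close> \<open>y \<le> \<rho>\<close>] by (simp_all add: le_fun_def)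
  then show "rank (y + unit_pt i) - rank y \<le> rank (x + unit_pt i) - rank x"
    using rank_add_unit_eq[OF x] rank_add_unit_eq[OF y] \<open>x i = y i\<close> by simp
qed (simp add: rank_def, use rank_add_unit_eq in simp)

text \<open>
  All increments at \<open>a\<close> are \<open>1\<close> exactly when \<open>cl a\<close> agrees with \<open>a\<close> in every coordinate; where
  \<open>a i = \<rho> i\<close>, no step is possible and the coordinates agree anyway.
\<close>

lemma flats_rank: "flats \<rho> rank = F"
proof -
  have "(\<forall>i. a + unit_pt i \<le> \<rho> \<longrightarrow> rank (a + unit_pt i) = rank a + 1) \<longleftrightarrow> a \<in> F"
    if a: "a \<le> \<rho>" for a
  proof -
    have "(a + unit_pt i \<le> \<rho> \<longrightarrow> rank (a + unit_pt i) = rank a + 1) \<longleftrightarrow> cl a i = a i" for i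
    proof (cases "a i < \<rho> i")
      case True
      then have "a + unit_pt i \<le> \<rho>" using a by (simp only: add_unit_le_iff)
      with rank_add_unit_eq[OF this] show ?thesis by simp
    next
      case False
      have "a i \<le> cl a i" "cl a i \<le> \<rho> i" using cl_ge[OF a] cl_le[OF a] by (simp_all add: le_fun_def)
      moreover have "\<not> a + unit_pt i \<le> \<rho>" using False unfolding add_unit_le_iff by blast
      ultimately show ?thesis using False by auto
    qed
    then show ?thesis using cl_eq_iff[OF a] by (simp add: fun_eq_iff)
  qed
  then show ?thesis using F_le by (auto simp: flats_def)
qed

end

section \<open>The characterization of the sets of flats\<close>

theorem theorem3p7:
  fixes \<rho> :: "'n::finite \<Rightarrow> nat"
  shows "(\<forall>r. matricube \<rho> r \<longrightarrow>
            F1 \<rho> (flats \<rho> r) \<and> F2 (flats \<rho> r) \<and> F3 \<rho> (flats \<rho> r)) \<and>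
         (\<forall>F. F \<subseteq> hypercuboid \<rho> \<and> F1 \<rho> F \<and> F2 F \<and> F3 \<rho> F \<longrightarrow>
            (\<exists>r. matricube \<rho> r \<and> flats \<rho> r = F)) \<and>
         (\<forall>r. matricube \<rho> r \<longrightarrow>
            (simple_matricube \<rho> r \<longleftrightarrow> (\<forall>i. \<rho> i > 0) \<and> Fstar \<rho> (flats \<rho> r)))"
proof (intro conjI allI impI)
  fix F :: "('n \<Rightarrow> nat) set"
  assume "F \<subseteq> hypercuboid \<rho> \<and> F1 \<rho> F \<and> F2 F \<and> F3 \<rho> F"
  then interpret flat_family \<rho> F by unfold_locales auto
  show "\<exists>r. matricube \<rho> r \<and> flats \<rho> r = F"
    using matricube_rank flats_rank by blast
next
  fix r assume "matricube \<rho> r"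
  then show "simple_matricube \<rho> r \<longleftrightarrow> (\<forall>i. \<rho> i > 0) \<and> Fstar \<rho> (flats \<rho> r)"
    using Fstar_if_simple simple_if_Fstar by (metis simple_matricube_def)
qed (simp_all add: flats_F1 flats_F2 flats_F3)

end
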